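(* Let $\langle\mathrm{Proc},\Sigma,\to\rangle$ be a labelled transition system over a finite alphabet $\Sigma$. The family $\mathcal B^{\mathrm{fin}}_{\mathrm{bis}}=\{O^k_{\mathrm{bis}}(q)\mid q\in\mathrm{Proc}_F,\ k\in\mathbb N\}$ is a basis for a topology $\tau^{\mathrm{fin}}_{\mathrm{bis}}$ on $\mathrm{Proc}$.
   Context: A labelled transition system is $\langle \mathrm{Proc},\Sigma,\to\rangle$ with $\to\subseteq \mathrm{Proc}\times\Sigma\times\mathrm{Proc}$. Finite loop-free processes: $\mathrm{Proc}_F$ is the set of terms generated by $q::=0\mid a.q\mid q+q$ with $a\in\Sigma$. Transitions: $q\xrightarrow{a}_F q'$ iff $q=a.q'$, or $q=q_1+q_2$ and ($q_1\xrightarrow{a}_F q'$ or $q_2\xrightarrow{a}_F q'$); $0$ has no transitions. $k$-bisimulation $\sim_k$ is defined inductively between processes of (possibly different) labelled transition systems over $\Sigma$: $x\sim_0 y$ always; $x\sim_{k+1}y$ iff (i) whenever $x\xrightarrow{a}x'$ there is $y'$ with $y\xrightarrow{a}y'$ and $x'\sim_k y'$, and (ii) whenever $y\xrightarrow{a}y'$ there is $x'$ with $x\xrightarrow{a}x'$ and $x'\sim_k y'$. For $q\in\mathrm{Proc}_F$ and $k\in\mathbb N$ ($0\in\mathbb N$), $O^k_{\mathrm{bis}}(q)=\{p\in\mathrm{Proc}\mid q\sim_k p\}$. *)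

theory Defs
  imports "HOL-Analysis.Abstract_Topology"
begin

definition lts :: "'p set \<Rightarrow> 'a set \<Rightarrow> ('p \<times> 'a \<times> 'p) set \<Rightarrow> bool" where
  "lts Proc \<Sigma> T \<longleftrightarrow> T \<subseteq> Proc \<times> \<Sigma> \<times> Proc"

datatype 'a fproc =
    Zero
  | Prefix 'a "'a fproc"
  | Choice "'a fproc" "'a fproc"

inductive_set Proc_F :: "'a set \<Rightarrow> 'a fproc set" for \<Sigma> :: "'a set" where
  zero: "Zero \<in> Proc_F \<Sigma>"
| prefix: "a \<in> \<Sigma> \<Longrightarrow> q \<in> Proc_F \<Sigma> \<Longrightarrow> Prefix a q \<in> Proc_F \<Sigma>"
| choice: "q1 \<in> Proc_F \<Sigma> \<Longrightarrow> q2 \<in> Proc_F \<Sigma> \<Longrightarrow> Choice q1 q2 \<in> Proc_F \<Sigma>"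

text \<open>
  The transitions are given for all terms over the label type. A transition out of a term
  of \<open>Proc_F \<Sigma>\<close> has its label in \<open>\<Sigma>\<close> and its target in \<open>Proc_F \<Sigma>\<close>, so no
  restriction to \<open>\<Sigma>\<close> is needed.
\<close>

inductive_set fin_trans :: "('a fproc \<times> 'a \<times> 'a fproc) set" where
  prefix: "(Prefix a q, a, q) \<in> fin_trans"
| choice1: "(q1, a, q') \<in> fin_trans \<Longrightarrow> (Choice q1 q2, a, q') \<in> fin_trans"
| choice2: "(q2, a, q') \<in> fin_trans \<Longrightarrow> (Choice q1 q2, a, q') \<in> fin_trans"

lemma lts_Proc_F: "lts (Proc_F \<Sigma>) \<Sigma> {(q, a, q') \<in> fin_trans. q \<in> Proc_F \<Sigma>}"
proof -
  have "q \<in> Proc_F \<Sigma> \<Longrightarrow> a \<in> \<Sigma> \<and> q' \<in> Proc_F \<Sigma>"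
    if "(q, a, q') \<in> fin_trans" for q a q'
    using that by induction (auto elim: Proc_F.cases)
  then show ?thesis
    by (auto simp: lts_def)
qed

primrec kbis ::
  "('p \<times> 'a \<times> 'p) set \<Rightarrow> ('r \<times> 'a \<times> 'r) set \<Rightarrow> nat \<Rightarrow> 'p \<Rightarrow> 'r \<Rightarrow> bool" where
  "kbis T U 0 x y \<longleftrightarrow> True"
| "kbis T U (Suc k) x y \<longleftrightarrow>
     (\<forall>a x'. (x, a, x') \<in> T \<longrightarrow> (\<exists>y'. (y, a, y') \<in> U \<and> kbis T U k x' y')) \<and>
     (\<forall>a y'. (y, a, y') \<in> U \<longrightarrow> (\<exists>x'. (x, a, x') \<in> T \<and> kbis T U k x' y'))"

definition O_bis :: "'p set \<Rightarrow> ('p \<times> 'a \<times> 'p) set \<Rightarrow> nat \<Rightarrow> 'a fproc \<Rightarrow> 'p set" where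
  "O_bis Proc T k q = {p \<in> Proc. kbis fin_trans T k q p}"

definition B_fin_bis :: "'p set \<Rightarrow> 'a set \<Rightarrow> ('p \<times> 'a \<times> 'p) set \<Rightarrow> 'p set set" where
  "B_fin_bis Proc \<Sigma> T = {O_bis Proc T k q | q k. q \<in> Proc_F \<Sigma>}"

end

theory Submission
  imports Defs
begin

text \<open>
  Since \<open>\<sim>\<^sub>k\<close> is coarser than \<open>\<sim>\<^sub>m\<close> for \<open>k \<le> m\<close>, and each basic set of level \<open>k\<close> is
  a full \<open>\<sim>\<^sub>k\<close>-class in \<open>Proc\<close>, two intersecting basic sets are nested: the one of
  higher level is contained in the other. The whole of \<open>Proc\<close> is the unique class of level \<open>0\<close>.
\<close>

text \<open>Exchanging the two systems swaps the forth clause with the back clause, and the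
  induction hypothesis turns the successors around.\<close>

lemma kbis_sym: "kbis T U k x y \<longleftrightarrow> kbis U T k y x"
proof (induction k arbitrary: x y)
  case (Suc k)
  show ?case
    unfolding kbis.simps Suc.IH by (rule conj_commute)
qed simp

lemma kbis_SucD1:
  "kbis T U (Suc k) x y \<Longrightarrow> (x, a, x') \<in> T \<Longrightarrow> \<exists>y'. (y, a, y') \<in> U \<and> kbis T U k x' y'"
  by simp

lemma kbis_SucD2:
  "kbis T U (Suc k) x y \<Longrightarrow> (y, a, y') \<in> U \<Longrightarrow> \<exists>x'. (x, a, x') \<in> T \<and> kbis T U k x' y'"
  by simp

lemma kbis_SucI:
  "(\<And>a x'. (x, a, x') \<in> T \<Longrightarrow> \<exists>y'. (y, a, y') \<in> U \<and> kbis T U k x' y') \<Longrightarrow>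
   (\<And>a y'. (y, a, y') \<in> U \<Longrightarrow> \<exists>x'. (x, a, x') \<in> T \<and> kbis T U k x' y') \<Longrightarrow>
   kbis T U (Suc k) x y"
  by simp

text \<open>Three systems are needed: \<open>O_bis_nested\<close> composes once through a term and
  once through a process of \<open>Proc\<close>.\<close>

lemma kbis_trans: "kbis T U k x y \<Longrightarrow> kbis U V k y z \<Longrightarrow> kbis T V k x z"
proof (induction k arbitrary: x y z)
  case (Suc k)
  show ?case
  proof (rule kbis_SucI)
    fix a x' assume "(x, a, x') \<in> T"
    then obtain y' where y': "(y, a, y') \<in> U" "kbis T U k x' y'"
      using kbis_SucD1[OF Suc.prems(1)] by blast
    then obtain z' where "(z, a, z') \<in> V" "kbis U V k y' z'"
      using kbis_SucD1[OF Suc.prems(2)] by blast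
    with y' show "\<exists>z'. (z, a, z') \<in> V \<and> kbis T V k x' z'"
      using Suc.IH by blast
  next
    fix a z' assume "(z, a, z') \<in> V"
    then obtain y' where y': "(y, a, y') \<in> U" "kbis U V k y' z'"
      using kbis_SucD2[OF Suc.prems(2)] by blast
    then obtain x' where "(x, a, x') \<in> T" "kbis T U k x' y'"
      using kbis_SucD2[OF Suc.prems(1)] by blast
    with y' show "\<exists>x'. (x, a, x') \<in> T \<and> kbis T V k x' z'"
      using Suc.IH by blast
  qed
qed simp

text \<open>The same matching successors serve at the lower level, since the induction hypothesis
  lowers their own level by one; level 0 asks for nothing.\<close>

lemma kbis_Suc_imp_kbis: "kbis T U (Suc k) x y \<Longrightarrow> kbis T U k x y"
proof (induction k arbitrary: x y)
  case (Suc k)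
  show ?case
    using Suc.IH kbis_SucD1[OF Suc.prems] kbis_SucD2[OF Suc.prems] by (intro kbis_SucI) blast+
qed simp

lemma kbis_antimono: "k \<le> m \<Longrightarrow> kbis T U m x y \<Longrightarrow> kbis T U k x y"
proof (induction m rule: dec_induct)
  case (step m)
  from step.IH[OF kbis_Suc_imp_kbis[OF step.prems]] show ?case .
qed

text \<open>The common point \<open>p\<close> links the classes: \<open>p'\<close> is tied to
  \<open>p\<close> through \<open>r\<close> at level \<open>m\<close>, hence also at level
  \<open>k\<close>, where \<open>p\<close> is tied to \<open>q\<close>.\<close>

lemma O_bis_nested:
  assumes "k \<le> m" and p: "p \<in> O_bis Proc T k q" "p \<in> O_bis Proc T m r"
  shows "O_bis Proc T m r \<subseteq> O_bis Proc T k q"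
proof
  fix p' assume p': "p' \<in> O_bis Proc T m r"
  have "kbis T fin_trans m p r"
    using p(2) by (simp add: O_bis_def kbis_sym[of T fin_trans])
  moreover have "kbis fin_trans T m r p'"
    using p' by (simp add: O_bis_def)
  ultimately have "kbis T T m p p'"
    by (rule kbis_trans)
  with \<open>k \<le> m\<close> have "kbis T T k p p'"
    by (rule kbis_antimono)
  moreover have "kbis fin_trans T k q p"
    using p(1) by (simp add: O_bis_def)
  ultimately have "kbis fin_trans T k q p'"
    by (metis kbis_trans)
  with p' show "p' \<in> O_bis Proc T k q"
    by (simp add: O_bis_def)
qed

lemma B_fin_bis_nested:
  assumes "A \<in> B_fin_bis Proc \<Sigma> T" "B \<in> B_fin_bis Proc \<Sigma> T" "A \<inter> B \<noteq> {}"
  shows "A \<subseteq> B \<or> B \<subseteq> A"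
proof -
  obtain k q m r where AB: "A = O_bis Proc T k q" "B = O_bis Proc T m r"
    using assms(1,2) by (auto simp: B_fin_bis_def)
  obtain p where p: "p \<in> O_bis Proc T k q" "p \<in> O_bis Proc T m r"
    using assms(3) AB by auto
  show ?thesis
    using linear[of k m] O_bis_nested[OF _ p] O_bis_nested[OF _ p(2) p(1)] unfolding AB by auto
qed

lemma Union_B_fin_bis: "\<Union> (B_fin_bis Proc \<Sigma> T) = Proc"
proof -
  \<comment> \<open>Any term would do at level 0; \<open>Zero\<close> is available over every
    alphabet, even the empty one.\<close>
  have "Proc = O_bis Proc T 0 Zero"
    by (simp add: O_bis_def)
  then have "Proc \<in> B_fin_bis Proc \<Sigma> T"
    unfolding B_fin_bis_def using Proc_F.zero by blast
  then show ?thesis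
    by (auto simp: B_fin_bis_def O_bis_def)
qed

theorem proposition5p22:
  fixes Proc :: "'p set" and \<Sigma> :: "'a set" and T :: "('p \<times> 'a \<times> 'p) set"
  assumes "lts Proc \<Sigma> T"
    and "finite \<Sigma>"
  shows "\<exists>\<tau>. topspace \<tau> = Proc \<and>
    openin \<tau> = arbitrary union_of (\<lambda>U. U \<in> B_fin_bis Proc \<Sigma> T)"
proof -
  let ?P = "\<lambda>U. U \<in> B_fin_bis Proc \<Sigma> T"
  have "istopology (arbitrary union_of ?P)"
    \<comment> \<open>It suffices that two basic sets meet in a union of basic sets.\<close>
    unfolding istopology_base_eq
  proof (intro allI impI)
    fix A B
    assume AB: "?P A \<and> ?P B"
    \<comment> \<open>A disjoint pair gives the union of the empty family; otherwise nesting makes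
      the intersection itself basic.\<close>
    then consider "A \<inter> B = {}" | "A \<inter> B = A" | "A \<inter> B = B"
      using B_fin_bis_nested[of A Proc \<Sigma> T B] by blast
    then show "(arbitrary union_of ?P) (A \<inter> B)"
      using AB by cases (auto intro: arbitrary_union_of_inc)
  qed
  then have op: "openin (topology (arbitrary union_of ?P)) = arbitrary union_of ?P"
    by (rule topology_inverse')
  have "topspace (topology (arbitrary union_of ?P)) = \<Union> (B_fin_bis Proc \<Sigma> T)"
  proof
    \<comment> \<open>The whole space is open, so it is a union of basic sets.\<close>
    obtain \<U> where "\<U> \<subseteq> B_fin_bis Proc \<Sigma> T"
      and "\<Union> \<U> = topspace (topology (arbitrary union_of ?P))"
      using openin_topspace[of "topology (arbitrary union_of ?P)"]
      unfolding op by (auto simp: union_of_def)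
    then show "topspace (topology (arbitrary union_of ?P)) \<subseteq> \<Union> (B_fin_bis Proc \<Sigma> T)"
      by blast
    show "\<Union> (B_fin_bis Proc \<Sigma> T) \<subseteq> topspace (topology (arbitrary union_of ?P))"
      by (intro Union_least openin_subset) (simp add: op arbitrary_union_of_inc)
  qed
  with op show ?thesis
    by (auto simp: Union_B_fin_bis)
qed

end
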